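(* Let $i \in \{1,\dots,M\}$, and let $c_j \in \mathbb{R}^{n_j}$ and $\alpha_j \ge 0$ for $j \in \{1,\dots,M\}$. Suppose there exist scalars $\lambda_{ij} \ge 0$, $j \in \mathcal{N}_i$, such that the symmetric block matrix $$ \begin{bmatrix} \alpha_i^{1/2} P_i^{-1} & (A_{\mathcal{N}_i}+B_iK_{\mathcal{N}_i})\,\alpha_{\mathcal{N}_i}^{1/2} & (A_{\mathcal{N}_i}+B_iK_{\mathcal{N}_i})c_{\mathcal{N}_i}-c_i\\ \big[(A_{\mathcal{N}_i}+B_iK_{\mathcal{N}_i})\,\alpha_{\mathcal{N}_i}^{1/2}\big]^\top & \sum_{j\in\mathcal{N}_i}\lambda_{ij}P_{ij} & 0\\ \big[(A_{\mathcal{N}_i}+B_iK_{\mathcal{N}_i})c_{\mathcal{N}_i}-c_i\big]^\top & 0 & \alpha_i^{1/2}-\sum_{j\in\mathcal{N}_i}\lambda_{ij} \end{bmatrix} $$ is positive semidefinite. Then the terminal set invariance condition holds: for every $x_{\mathcal{N}_i}\in\mathbb{R}^{n_{N_i}}$ whose components $x_j$, $j \in \mathcal{N}_i$, satisfy $(x_j-c_j)^\top P_j(x_j-c_j)\le\alpha_j$ for all $j\in\mathcal{N}_i$, $$ \big[(A_{\mathcal{N}_i}+B_iK_{\mathcal{N}_i})x_{\mathcal{N}_i}-c_i\big]^\top P_i\big[(A_{\mathcal{N}_i}+B_iK_{\mathcal{N}_i})x_{\mathcal{N}_i}-c_i\big]\le\alpha_i . $$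
   Context: A system is composed of $M$ subsystems; subsystem $j$ has state $x_j\in\mathbb{R}^{n_j}$ and input $u_j\in\mathbb{R}^{m_j}$. The global state is $x=[x_1^\top,\dots,x_M^\top]^\top\in\mathbb{R}^n$. For each $i$, $\mathcal{N}_i\subseteq\{1,\dots,M\}$ is the set of neighbors of subsystem $i$, with $i\in\mathcal{N}_i$, and $x_{\mathcal{N}_i}\in\mathbb{R}^{n_{N_i}}$ is the concatenation of the $x_j$, $j\in\mathcal{N}_i$ (so $n_{N_i}=\sum_{j\in\mathcal{N}_i}n_j$). $U_j\in\{0,1\}^{n_j\times n}$ and $W_{\mathcal{N}_i}\in\{0,1\}^{n_{N_i}\times n}$ are the selection matrices with $x_j=U_jx$ and $x_{\mathcal{N}_i}=W_{\mathcal{N}_i}x$. The dynamics are $x_i(t+1)=A_{\mathcal{N}_i}x_{\mathcal{N}_i}(t)+B_iu_i(t)$ with given real matrices $A_{\mathcal{N}_i}\in\mathbb{R}^{n_i\times n_{N_i}}$, $B_i\in\mathbb{R}^{n_i\times m_i}$. A terminal controller $u_i=K_{\mathcal{N}_i}x_{\mathcal{N}_i}$ with gain $K_{\mathcal{N}_i}\in\mathbb{R}^{m_i\times n_{N_i}}$ and symmetric positive definite matrices $P_j\in\mathbb{R}^{n_j\times n_j}$ are given. The terminal set of subsystem $j$ is the ellipsoid $\{x_j:(x_j-c_j)^\top P_j(x_j-c_j)\le\alpha_j\}$ with center $c_j$ and size $\alpha_j$. Notation: $\alpha=\operatorname{diag}(\alpha_1I_{n_1},\dots,\alpha_MI_{n_M})$,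 $c=[c_1^\top,\dots,c_M^\top]^\top$, $\alpha_{\mathcal{N}_i}=W_{\mathcal{N}_i}\alpha W_{\mathcal{N}_i}^\top$ (diagonal, with entrywise square root $\alpha_{\mathcal{N}_i}^{1/2}$ on the diagonal), $c_{\mathcal{N}_i}=W_{\mathcal{N}_i}c$. For $j\in\mathcal{N}_i$, $P_{ij}=W_{\mathcal{N}_i}U_j^\top P_jU_jW_{\mathcal{N}_i}^\top$, i.e. the block-diagonal matrix with block $P_j$ at the position of $x_j$ in $x_{\mathcal{N}_i}$ and zeros elsewhere, so that $s_{\mathcal{N}_i}^\top P_{ij}s_{\mathcal{N}_i}=s_j^\top P_js_j$. *)

theory Defs
  imports Complex_Main "Jordan_Normal_Form.Gauss_Jordan_Elimination"
begin

definition pos_semidef_mat :: "real mat \<Rightarrow> bool" where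
  "pos_semidef_mat Q \<longleftrightarrow> square_mat Q \<and> transpose_mat Q = Q \<and>
     (\<forall>v \<in> carrier_vec (dim_row Q). 0 \<le> v \<bullet> (Q *\<^sub>v v))"

definition pos_def_mat :: "real mat \<Rightarrow> bool" where
  "pos_def_mat Q \<longleftrightarrow> square_mat Q \<and> transpose_mat Q = Q \<and>
     (\<forall>v \<in> carrier_vec (dim_row Q). v \<noteq> 0\<^sub>v (dim_row Q) \<longrightarrow> 0 < v \<bullet> (Q *\<^sub>v v))"

definition append_cols :: "'a::zero mat \<Rightarrow> 'a mat \<Rightarrow> 'a mat"  (infixr \<open>|\<^sub>c\<close> 66) where
  "X |\<^sub>c Y = transpose_mat (transpose_mat X @\<^sub>r transpose_mat Y)"

definition col_mat :: "'a vec \<Rightarrow> 'a mat" where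
  "col_mat v = mat_of_cols (dim_vec v) [v]"

text \<open>Subsystems are numbered from 1 to \<open>M\<close>, and \<open>n j\<close> is the state dimension of subsystem \<open>j\<close>.
  Concatenations over an index set follow the increasing order of the indices.\<close>

definition stacked_dim :: "(nat \<Rightarrow> nat) \<Rightarrow> nat set \<Rightarrow> nat" where
  "stacked_dim n S = (\<Sum>j\<in>S. n j)"

definition stack :: "(nat \<Rightarrow> 'a vec) \<Rightarrow> nat set \<Rightarrow> 'a vec" where
  "stack x S = foldr (\<lambda>j v. x j @\<^sub>v v) (sorted_list_of_set S) vNil"

text \<open>\<open>U_mat M n j\<close> and \<open>W_mat M n S\<close> are the 0/1 selection matrices sending the global state
  to \<open>x j\<close> and to \<open>stack x S\<close>; see \<open>U_mat_stack\<close> and \<open>W_mat_stack\<close> below. The entries of \<open>x j\<close>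
  occupy the positions \<open>stacked_dim n {1..<j} + r\<close>, \<open>r < n j\<close>, of the global state.\<close>

definition U_mat :: "nat \<Rightarrow> (nat \<Rightarrow> nat) \<Rightarrow> nat \<Rightarrow> real mat" where
  "U_mat M n j = mat (n j) (stacked_dim n {1..M})
     (\<lambda>(r, s). if s = stacked_dim n {1..<j} + r then 1 else 0)"

definition W_mat :: "nat \<Rightarrow> (nat \<Rightarrow> nat) \<Rightarrow> nat set \<Rightarrow> real mat" where
  "W_mat M n S = foldr (\<lambda>j X. U_mat M n j @\<^sub>r X) (sorted_list_of_set S)
     (0\<^sub>m 0 (stacked_dim n {1..M}))"

definition alpha_mat :: "nat \<Rightarrow> (nat \<Rightarrow> nat) \<Rightarrow> (nat \<Rightarrow> real) \<Rightarrow> real mat" where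
  "alpha_mat M n \<alpha> = diag_block_mat (map (\<lambda>j. \<alpha> j \<cdot>\<^sub>m 1\<^sub>m (n j)) (sorted_list_of_set {1..M}))"

definition alpha_nbr :: "nat \<Rightarrow> (nat \<Rightarrow> nat) \<Rightarrow> (nat \<Rightarrow> real) \<Rightarrow> nat set \<Rightarrow> real mat" where
  "alpha_nbr M n \<alpha> S = W_mat M n S * alpha_mat M n \<alpha> * transpose_mat (W_mat M n S)"

definition c_nbr :: "nat \<Rightarrow> (nat \<Rightarrow> nat) \<Rightarrow> (nat \<Rightarrow> real vec) \<Rightarrow> nat set \<Rightarrow> real vec" where
  "c_nbr M n c S = W_mat M n S *\<^sub>v stack c {1..M}"

definition P_nbr ::
  "nat \<Rightarrow> (nat \<Rightarrow> nat) \<Rightarrow> (nat \<Rightarrow> real mat) \<Rightarrow> nat set \<Rightarrow> nat \<Rightarrow> real mat" where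
  "P_nbr M n P S j = W_mat M n S * transpose_mat (U_mat M n j) * P j
     * U_mat M n j * transpose_mat (W_mat M n S)"

text \<open>The block matrix of the invariance condition for subsystem \<open>i\<close> with neighbours \<open>S\<close>,
  where \<open>F\<close> is the closed-loop matrix, mapping the stacked neighbour state to the next state of
  subsystem \<open>i\<close>, and \<open>l\<close> the multipliers.\<close>

definition invariance_lmi ::
  "nat \<Rightarrow> (nat \<Rightarrow> nat) \<Rightarrow> (nat \<Rightarrow> real mat) \<Rightarrow> (nat \<Rightarrow> real vec) \<Rightarrow> (nat \<Rightarrow> real)
     \<Rightarrow> nat set \<Rightarrow> nat \<Rightarrow> real mat \<Rightarrow> (nat \<Rightarrow> real) \<Rightarrow> real mat" where
  "invariance_lmi M n P c \<alpha> S i F l =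
    (let d = stacked_dim n S;
         G = F * map_mat sqrt (alpha_nbr M n \<alpha> S);
         h = col_mat (F *\<^sub>v c_nbr M n c S - c i)
     in (sqrt (\<alpha> i) \<cdot>\<^sub>m the (mat_inverse (P i)) |\<^sub>c G |\<^sub>c h) @\<^sub>r
        (transpose_mat G
           |\<^sub>c (\<Oplus>\<^bsub>module_mat TYPE(real) d d\<^esub>j\<in>S. l j \<cdot>\<^sub>m P_nbr M n P S j)
           |\<^sub>c 0\<^sub>m d 1) @\<^sub>r
        (transpose_mat h |\<^sub>c 0\<^sub>m 1 d |\<^sub>c mat 1 1 (\<lambda>_. sqrt (\<alpha> i) - (\<Sum>j\<in>S. l j))))"

lemma dim_foldr_append_vec:
  "dim_vec (foldr (\<lambda>j v. x j @\<^sub>v v) js vNil) = (\<Sum>j\<leftarrow>js. dim_vec (x j))"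
  by (induction js) auto

lemma dim_stack:
  assumes "finite S" "\<And>j. j \<in> S \<Longrightarrow> x j \<in> carrier_vec (n j)"
  shows "stack x S \<in> carrier_vec (stacked_dim n S)"
proof -
  have "dim_vec (stack x S) = (\<Sum>j\<in>S. dim_vec (x j))"
    unfolding stack_def dim_foldr_append_vec
    using assms(1) sum_list_distinct_conv_sum_set[of "sorted_list_of_set S" "\<lambda>j. dim_vec (x j)"]
    by simp
  also have "\<dots> = stacked_dim n S"
    unfolding stacked_dim_def using assms(2) by (intro sum.cong) auto
  finally show ?thesis by (rule carrier_vecI)
qed

lemma stack_exhaust:
  assumes "finite S" "v \<in> carrier_vec (stacked_dim n S)"
  obtains x where "\<And>j. j \<in> S \<Longrightarrow> x j \<in> carrier_vec (n j)" "v = stack x S"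
proof -
  have "\<exists>x. (\<forall>j\<in>set js. x j \<in> carrier_vec (n j)) \<and> v = foldr (\<lambda>j v. x j @\<^sub>v v) js vNil"
    if "distinct js" "v \<in> carrier_vec (\<Sum>j\<leftarrow>js. n j)" for js :: "nat list" and v :: "'a vec"
    using that
  proof (induction js arbitrary: v)
    case Nil
    then show ?case by (auto intro: eq_vecI)
  next
    case (Cons j js)
    let ?k = "\<Sum>j\<leftarrow>js. n j"
    obtain x where x: "\<forall>j\<in>set js. x j \<in> carrier_vec (n j)"
      "vec_last v ?k = foldr (\<lambda>j v. x j @\<^sub>v v) js vNil"
      using Cons.IH[of "vec_last v ?k"] Cons.prems(1) by auto
    let ?y = "x(j := vec_first v (n j))"
    have "foldr (\<lambda>j v. ?y j @\<^sub>v v) js vNil = foldr (\<lambda>j v. x j @\<^sub>v v) js vNil"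
      using Cons.prems(1) by (intro foldr_cong) auto
    moreover have "v = vec_first v (n j) @\<^sub>v vec_last v ?k"
      using Cons.prems(2) by simp
    ultimately show ?case using x by (intro exI[of _ ?y]) auto
  qed
  from this[of "sorted_list_of_set S" v] show ?thesis
    using assms that sum_list_distinct_conv_sum_set[of "sorted_list_of_set S" n]
    by (auto simp: stack_def stacked_dim_def)
qed

lemma index_foldr_append_vec:
  assumes "r < dim_vec (x j)"
  shows "foldr (\<lambda>j v. x j @\<^sub>v v) (ks @ j # js) vNil $ ((\<Sum>k\<leftarrow>ks. dim_vec (x k)) + r) = x j $ r"
  using assms
proof (induction ks)
  case (Cons a ks)
  let ?v = "foldr (\<lambda>j v. x j @\<^sub>v v) (ks @ j # js) vNil"
  let ?p = "(\<Sum>k\<leftarrow>ks. dim_vec (x k)) + r"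
  have "?p < dim_vec ?v" using Cons.prems unfolding dim_foldr_append_vec by simp
  then have "(x a @\<^sub>v ?v) $ (dim_vec (x a) + ?p) = ?v $ ?p"
    by (subst index_append_vec) auto
  then show ?case using Cons by (simp add: add.assoc)
qed simp

lemma index_stack_all:
  assumes "j \<in> {1..M}" "\<And>j. j \<in> {1..M} \<Longrightarrow> x j \<in> carrier_vec (n j)" "r < n j"
  shows "stack x {1..M} $ (stacked_dim n {1..<j} + r) = x j $ r"
proof -
  have l: "sorted_list_of_set {1..M} = [1..<j] @ j # [Suc j..<Suc M]"
  proof -
    have "sorted_list_of_set {1..M} = [1..<Suc M]"
      by (simp only: atLeastLessThanSuc_atLeastAtMost[symmetric] sorted_list_of_set_range)
    also have "\<dots> = [1..<j] @ [j..<Suc M]"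
      using assms(1) upt_add_eq_append[of 1 j "Suc M - j"] by simp
    also have "[j..<Suc M] = j # [Suc j..<Suc M]"
      using assms(1) by (intro upt_conv_Cons) simp
    finally show ?thesis .
  qed
  have s: "(\<Sum>k\<leftarrow>[1..<j]. dim_vec (x k)) = stacked_dim n {1..<j}"
  proof -
    have "(\<Sum>k\<leftarrow>[1..<j]. dim_vec (x k)) = (\<Sum>k\<in>{1..<j}. dim_vec (x k))"
      by (simp add: sum_list_distinct_conv_sum_set)
    also have "\<dots> = stacked_dim n {1..<j}"
    proof -
      have "dim_vec (x k) = n k" if "k \<in> {1..<j}" for k
        using assms(1) assms(2)[of k] that by auto
      then show ?thesis unfolding stacked_dim_def by (intro sum.cong) auto
    qed
    finally show ?thesis .
  qed
  show ?thesis
    unfolding stack_def l s[symmetric]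
    using assms(1,3) assms(2)[of j] by (intro index_foldr_append_vec) auto
qed

lemma U_mat_stack:
  assumes "j \<in> {1..M}" "\<And>j. j \<in> {1..M} \<Longrightarrow> x j \<in> carrier_vec (n j)"
  shows "U_mat M n j *\<^sub>v stack x {1..M} = x j"
proof (rule eq_vecI)
  have xj: "dim_vec (x j) = n j" using assms(1) assms(2)[of j] by auto
  then show "dim_vec (U_mat M n j *\<^sub>v stack x {1..M}) = dim_vec (x j)" by (simp add: U_mat_def)
  fix r assume "r < dim_vec (x j)"
  then have r: "r < n j" using xj by simp
  let ?s = "stacked_dim n {1..<j} + r"
  have d: "dim_vec (stack x {1..M}) = stacked_dim n {1..M}"
    using dim_stack[of "{1..M}" x n] assms(2) by auto
  have "stacked_dim n {1..<j} + n j = stacked_dim n {1..<Suc j}"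
    unfolding stacked_dim_def using assms(1) by simp
  also have "\<dots> \<le> stacked_dim n {1..M}"
    unfolding stacked_dim_def using assms(1) by (intro sum_mono2) auto
  finally have s: "?s < stacked_dim n {1..M}" using r by linarith
  have "(U_mat M n j *\<^sub>v stack x {1..M}) $ r
      = (\<Sum>k\<in>{0..<stacked_dim n {1..M}}. (if k = ?s then 1 else 0) * stack x {1..M} $ k)"
    unfolding U_mat_def using r d by (simp add: scalar_prod_def)
  also have "\<dots> = (\<Sum>k\<in>{0..<stacked_dim n {1..M}}. if k = ?s then stack x {1..M} $ k else 0)"
    by (intro sum.cong) auto
  also have "\<dots> = stack x {1..M} $ ?s" using s by simp
  also have "\<dots> = x j $ r" using assms r by (intro index_stack_all) auto
  finally show "(U_mat M n j *\<^sub>v stack x {1..M}) $ r = x j $ r" .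
qed

lemma W_mat_stack:
  assumes "S \<subseteq> {1..M}" "\<And>j. j \<in> {1..M} \<Longrightarrow> x j \<in> carrier_vec (n j)"
  shows "W_mat M n S *\<^sub>v stack x {1..M} = stack x S"
proof -
  let ?d = "stacked_dim n {1..M}"
  let ?W = "\<lambda>js. foldr (\<lambda>j X. U_mat M n j @\<^sub>r X) js (0\<^sub>m 0 ?d)"
  have v: "stack x {1..M} \<in> carrier_vec ?d" using assms(2) by (intro dim_stack) auto
  have W: "?W js \<in> carrier_mat (\<Sum>j\<leftarrow>js. n j) ?d" for js
    by (induction js) (auto simp: U_mat_def append_rows_def)
  have "?W js *\<^sub>v stack x {1..M} = foldr (\<lambda>j v. x j @\<^sub>v v) js vNil" if "set js \<subseteq> {1..M}" for js
    using that
  proof (induction js)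
    case Nil
    show ?case by (rule eq_vecI) auto
  next
    case (Cons j js)
    have U: "U_mat M n j \<in> carrier_mat (n j) ?d" by (simp add: U_mat_def)
    have "?W (j # js) *\<^sub>v stack x {1..M}
        = (U_mat M n j *\<^sub>v stack x {1..M}) @\<^sub>v (?W js *\<^sub>v stack x {1..M})"
      using mat_mult_append[OF U W v] by simp
    moreover have "U_mat M n j *\<^sub>v stack x {1..M} = x j"
      using Cons.prems assms(2) by (intro U_mat_stack) auto
    ultimately show ?case using Cons by simp
  qed
  moreover have "set (sorted_list_of_set S) \<subseteq> {1..M}"
    using assms(1) finite_subset[OF assms(1)] by simp
  ultimately show ?thesis unfolding W_mat_def stack_def[of x S] by blast
qed

end

theory Submission
  imports Defs "Jordan_Normal_Form.Determinant"
begin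

text \<open>This is the sufficient direction of the S-procedure. Writing \<open>x j = c j + sqrt (\<alpha> j) \<cdot>\<^sub>v s j\<close>
  with \<open>s j \<bullet> (P j *\<^sub>v s j) \<le> 1\<close> turns \<open>y = F *\<^sub>v xN - c i\<close> into \<open>G *\<^sub>v s + h\<close>, where \<open>G\<close> and \<open>h\<close>
  are the off-diagonal blocks of the first block row and \<open>s\<close> is stacked. Testing the block matrix on
  \<open>(w, s, 1)\<close> and bounding \<open>\<Sum>j. l j * (s j \<bullet> (P j *\<^sub>v s j))\<close> by \<open>\<Sum>j. l j\<close> removes the multipliers and
  leaves \<open>0 \<le> a * (w \<bullet> (R *\<^sub>v w)) + 2 * (w \<bullet> y) + a\<close> for all \<open>w\<close>, with \<open>a = sqrt (\<alpha> i)\<close> and \<open>R\<close>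
  the inverse of \<open>P i\<close>. A choice of \<open>w\<close> along \<open>P i *\<^sub>v y\<close> gives \<open>y \<bullet> (P i *\<^sub>v y) \<le> \<alpha> i\<close>.\<close>

text \<open>The last block of the matrix has dimension 1. Keeping this \<open>1\<close> from
  becoming \<open>Suc 0\<close> lets dimensions such as \<open>d + 1\<close> match
  syntactically.\<close>

declare One_nat_def [simp del]

section \<open>Extensionality and block matrices acting on vectors\<close>

text \<open>Testing against unit vectors reads off the coordinates. This form suits products with
  transposed matrices, because the transpose can be moved across the scalar product.\<close>

lemma eq_vec_scalar_prodI:
  fixes v w :: "'a::semiring_1 vec"
  assumes v: "v \<in> carrier_vec d" and w: "w \<in> carrier_vec d"
    and eq: "\<And>u. u \<in> carrier_vec d \<Longrightarrow> v \<bullet> u = w \<bullet> u"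
  shows "v = w"
proof (rule eq_vecI)
  fix r assume "r < dim_vec w"
  then show "v $ r = w $ r"
    using eq[of "unit_vec d r"] v w by (simp add: scalar_prod_right_unit)
qed (use v w in auto)

lemma eq_mat_mult_vecI:
  fixes X Y :: "'a::semiring_1 mat"
  assumes X: "X \<in> carrier_mat nr nc" and Y: "Y \<in> carrier_mat nr nc"
    and eq: "\<And>v. v \<in> carrier_vec nc \<Longrightarrow> X *\<^sub>v v = Y *\<^sub>v v"
  shows "X = Y"
proof (rule eq_matI)
  fix r s assume r: "r < dim_row Y" and s: "s < dim_col Y"
  have "(X *\<^sub>v unit_vec nc s) $ r = (Y *\<^sub>v unit_vec nc s) $ r" using eq by simp
  then show "X $$ (r, s) = Y $$ (r, s)"
    using X Y r s by (simp add: scalar_prod_right_unit)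
qed (use X Y in auto)

lemma smult_mat_mult_vec:
  fixes Q :: "'a::comm_ring_1 mat"
  assumes "v \<in> carrier_vec (dim_col Q)"
  shows "(k \<cdot>\<^sub>m Q) *\<^sub>v v = k \<cdot>\<^sub>v (Q *\<^sub>v v)"
  using assms by (intro eq_vecI) auto

lemma append_cols_carrier [simp]:
  assumes "X \<in> carrier_mat nr n1" "Y \<in> carrier_mat nr n2"
  shows "X |\<^sub>c Y \<in> carrier_mat nr (n1 + n2)"
  using assms unfolding append_cols_def by simp

text \<open>Since \<open>append_cols\<close> is row appending conjugated by transposition, the
  product is paired with an arbitrary \<open>u\<close>; the transpose moves over to
  \<open>u\<close>, where \<open>mat_mult_append\<close> splits it.\<close>

lemma append_cols_mult_vec:
  fixes X Y :: "'a::comm_semiring_1 mat"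
  assumes X: "X \<in> carrier_mat nr n1" and Y: "Y \<in> carrier_mat nr n2"
    and a: "a \<in> carrier_vec n1" and b: "b \<in> carrier_vec n2"
  shows "(X |\<^sub>c Y) *\<^sub>v (a @\<^sub>v b) = X *\<^sub>v a + Y *\<^sub>v b"
proof (rule eq_vec_scalar_prodI)
  have Xt: "transpose_mat X \<in> carrier_mat n1 nr" and Yt: "transpose_mat Y \<in> carrier_mat n2 nr"
    using X Y by auto
  then have T: "transpose_mat X @\<^sub>r transpose_mat Y \<in> carrier_mat (n1 + n2) nr" by simp
  show "(X |\<^sub>c Y) *\<^sub>v (a @\<^sub>v b) \<in> carrier_vec nr" "X *\<^sub>v a + Y *\<^sub>v b \<in> carrier_vec nr"
    using append_cols_carrier[OF X Y] X Y a b by (auto intro!: mult_mat_vec_carrier add_carrier_vec)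
  fix u :: "'a vec" assume u: "u \<in> carrier_vec nr"
  have "((X |\<^sub>c Y) *\<^sub>v (a @\<^sub>v b)) \<bullet> u
      = (a @\<^sub>v b) \<bullet> ((transpose_mat X *\<^sub>v u) @\<^sub>v (transpose_mat Y *\<^sub>v u))"
    unfolding append_cols_def using X Y a b u
    by (subst transpose_vec_mult_scalar[OF T u]) (auto simp: mat_mult_append[of _ n1 nr _ n2])
  also have "\<dots> = a \<bullet> (transpose_mat X *\<^sub>v u) + b \<bullet> (transpose_mat Y *\<^sub>v u)"
    using Xt Yt a b u by (intro scalar_prod_append) auto
  also have "a \<bullet> (transpose_mat X *\<^sub>v u) = (X *\<^sub>v a) \<bullet> u"
    using transpose_vec_mult_scalar[of "transpose_mat X" n1 nr u a] X a u by simp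
  also have "b \<bullet> (transpose_mat Y *\<^sub>v u) = (Y *\<^sub>v b) \<bullet> u"
    using transpose_vec_mult_scalar[of "transpose_mat Y" n2 nr u b] Y b u by simp
  also have "(X *\<^sub>v a) \<bullet> u + (Y *\<^sub>v b) \<bullet> u = (X *\<^sub>v a + Y *\<^sub>v b) \<bullet> u"
    using X Y a b u by (intro add_scalar_prod_distrib[symmetric]) auto
  finally show "((X |\<^sub>c Y) *\<^sub>v (a @\<^sub>v b)) \<bullet> u = (X *\<^sub>v a + Y *\<^sub>v b) \<bullet> u" .
qed

text \<open>The trailing entry 1 of \<open>v\<close> makes the form inhomogeneous in
  \<open>w\<close> and \<open>s\<close>: the last block row and column supply the linear term in
  \<open>h\<close> and the constant \<open>\<rho>\<close>. The blocks \<open>G\<close> and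
  \<open>h\<close> each occur together with their transpose, hence the factor 2.\<close>

lemma block_quadratic_form:
  fixes X G Q :: "real mat" and h w s :: "real vec" and \<rho> :: real
  assumes X: "X \<in> carrier_mat p p" and G: "G \<in> carrier_mat p d" and Q: "Q \<in> carrier_mat d d"
    and h: "h \<in> carrier_vec p" and w: "w \<in> carrier_vec p" and s: "s \<in> carrier_vec d"
  defines "v \<equiv> w @\<^sub>v s @\<^sub>v vec 1 (\<lambda>_. 1)"
    and "Z \<equiv> (X |\<^sub>c G |\<^sub>c col_mat h) @\<^sub>r (transpose_mat G |\<^sub>c Q |\<^sub>c 0\<^sub>m d 1) @\<^sub>r
        (transpose_mat (col_mat h) |\<^sub>c 0\<^sub>m 1 d |\<^sub>c mat 1 1 (\<lambda>_. \<rho>))"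
  shows "Z \<in> carrier_mat (p + (d + 1)) (p + (d + 1))" "v \<in> carrier_vec (p + (d + 1))"
    and "v \<bullet> (Z *\<^sub>v v) = w \<bullet> (X *\<^sub>v w) + 2 * (w \<bullet> (G *\<^sub>v s + h)) + s \<bullet> (Q *\<^sub>v s) + \<rho>"
proof -
  let ?e = "vec 1 (\<lambda>_. 1) :: real vec"
  let ?H = "col_mat h"
  have H: "?H \<in> carrier_mat p 1" using h unfolding col_mat_def by auto
  have Ht: "transpose_mat ?H \<in> carrier_mat 1 p" using H by simp
  have Gt: "transpose_mat G \<in> carrier_mat d p" using G by simp
  have R: "mat 1 1 (\<lambda>_. \<rho>) \<in> carrier_mat 1 1" by simp
  have e: "?e \<in> carrier_vec 1" by simp
  have se: "s @\<^sub>v ?e \<in> carrier_vec (d + 1)" using s by simp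
  show v: "v \<in> carrier_vec (p + (d + 1))" unfolding v_def using w se by simp
  have r1: "X |\<^sub>c G |\<^sub>c ?H \<in> carrier_mat p (p + (d + 1))"
    using X G H by (intro append_cols_carrier)
  have r2: "transpose_mat G |\<^sub>c Q |\<^sub>c 0\<^sub>m d 1 \<in> carrier_mat d (p + (d + 1))"
    using Gt Q by (intro append_cols_carrier) auto
  have r3: "transpose_mat ?H |\<^sub>c 0\<^sub>m 1 d |\<^sub>c mat 1 1 (\<lambda>_. \<rho>) \<in> carrier_mat 1 (p + (d + 1))"
    using Ht by (intro append_cols_carrier) auto
  show "Z \<in> carrier_mat (p + (d + 1)) (p + (d + 1))"
    unfolding Z_def using r1 r2 r3 by (intro carrier_append_rows)
  have He: "?H *\<^sub>v ?e = h"
    using h by (intro eq_vecI) (auto simp: col_mat_def scalar_prod_def mat_of_cols_def)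
  have v1: "(X |\<^sub>c G |\<^sub>c ?H) *\<^sub>v v = X *\<^sub>v w + (G *\<^sub>v s + h)"
    unfolding v_def append_cols_mult_vec[OF X append_cols_carrier[OF G H] w se]
      append_cols_mult_vec[OF G H s e] He ..
  have v2: "(transpose_mat G |\<^sub>c Q |\<^sub>c 0\<^sub>m d 1) *\<^sub>v v = transpose_mat G *\<^sub>v w + Q *\<^sub>v s"
    unfolding v_def
      append_cols_mult_vec[OF Gt append_cols_carrier[OF Q zero_carrier_mat] w se]
      append_cols_mult_vec[OF Q zero_carrier_mat s e]
    using Q s by (intro arg_cong2[of _ _ _ _ "(+)"] eq_vecI) auto
  have v3: "(transpose_mat ?H |\<^sub>c 0\<^sub>m 1 d |\<^sub>c mat 1 1 (\<lambda>_. \<rho>)) *\<^sub>v v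
      = transpose_mat ?H *\<^sub>v w + vec 1 (\<lambda>_. \<rho>)"
    unfolding v_def
      append_cols_mult_vec[OF Ht append_cols_carrier[OF zero_carrier_mat R] w se]
      append_cols_mult_vec[OF zero_carrier_mat R s e]
    using s by (intro arg_cong2[of _ _ _ _ "(+)"] eq_vecI) (auto simp: scalar_prod_def)
  have "Z *\<^sub>v v = (X *\<^sub>v w + (G *\<^sub>v s + h)) @\<^sub>v (transpose_mat G *\<^sub>v w + Q *\<^sub>v s)
      @\<^sub>v (transpose_mat ?H *\<^sub>v w + vec 1 (\<lambda>_. \<rho>))"
    unfolding Z_def mat_mult_append[OF r1 carrier_append_rows[OF r2 r3] v]
      mat_mult_append[OF r2 r3 v] v1 v2 v3 ..
  then have "v \<bullet> (Z *\<^sub>v v) = w \<bullet> (X *\<^sub>v w + (G *\<^sub>v s + h))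
      + (s \<bullet> (transpose_mat G *\<^sub>v w + Q *\<^sub>v s)
        + ?e \<bullet> (transpose_mat ?H *\<^sub>v w + vec 1 (\<lambda>_. \<rho>)))"
    unfolding v_def using X G Q H h w s
    by (simp add: scalar_prod_append[of _ p _ "d + 1"] scalar_prod_append[of _ d _ 1])
  also have "w \<bullet> (X *\<^sub>v w + (G *\<^sub>v s + h)) = w \<bullet> (X *\<^sub>v w) + w \<bullet> (G *\<^sub>v s + h)"
    using X G h w s by (intro scalar_prod_add_distrib) auto
  also have "s \<bullet> (transpose_mat G *\<^sub>v w + Q *\<^sub>v s)
      = s \<bullet> (transpose_mat G *\<^sub>v w) + s \<bullet> (Q *\<^sub>v s)"
    using G Q w s by (intro scalar_prod_add_distrib) auto
  \<comment> \<open>The lower copy of \<open>G\<close> contributes the same number as the upper one;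
    \<open>h\<close> is treated likewise below.\<close>
  also have "s \<bullet> (transpose_mat G *\<^sub>v w) = w \<bullet> (G *\<^sub>v s)"
    using transpose_vec_mult_scalar[OF G s w] G s w
    by (subst comm_scalar_prod[of _ d]) auto
  also have "?e \<bullet> (transpose_mat ?H *\<^sub>v w + vec 1 (\<lambda>_. \<rho>))
      = ?e \<bullet> (transpose_mat ?H *\<^sub>v w) + ?e \<bullet> vec 1 (\<lambda>_. \<rho>)"
    using H w by (intro scalar_prod_add_distrib[of _ 1]) auto
  also have "?e \<bullet> (transpose_mat ?H *\<^sub>v w) = w \<bullet> h"
    using transpose_vec_mult_scalar[OF H e w] H w He
    by (subst comm_scalar_prod[of _ 1]) auto
  also have "?e \<bullet> vec 1 (\<lambda>_. \<rho>) = \<rho>" by (simp add: scalar_prod_def)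
  finally have "v \<bullet> (Z *\<^sub>v v) = w \<bullet> (X *\<^sub>v w) + w \<bullet> (G *\<^sub>v s + h)
      + (w \<bullet> (G *\<^sub>v s) + s \<bullet> (Q *\<^sub>v s) + (w \<bullet> h + \<rho>))" .
  moreover have "w \<bullet> (G *\<^sub>v s + h) = w \<bullet> (G *\<^sub>v s) + w \<bullet> h"
    using G h w s by (intro scalar_prod_add_distrib) auto
  ultimately show "v \<bullet> (Z *\<^sub>v v)
      = w \<bullet> (X *\<^sub>v w) + 2 * (w \<bullet> (G *\<^sub>v s + h)) + s \<bullet> (Q *\<^sub>v s) + \<rho>"
    by simp
qed

section \<open>Sums of matrices and inverses of positive definite matrices\<close>

text \<open>Membership in the carrier and the value of the form go through one induction, because
  distributing over \<open>Q j + ?T\<close> requires the dimensions of the partial sum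
  \<open>?T\<close>.\<close>

lemma finsum_mat_mult_vec:
  fixes Q :: "'b \<Rightarrow> real mat"
  assumes "finite S" "\<And>j. j \<in> S \<Longrightarrow> Q j \<in> carrier_mat d d" "s \<in> carrier_vec d"
  shows "(\<Oplus>\<^bsub>module_mat TYPE(real) d d\<^esub>j\<in>S. Q j) \<in> carrier_mat d d \<and>
    s \<bullet> ((\<Oplus>\<^bsub>module_mat TYPE(real) d d\<^esub>j\<in>S. Q j) *\<^sub>v s) = (\<Sum>j\<in>S. s \<bullet> (Q j *\<^sub>v s))"
  using assms
proof (induction S)
  interpret abelian_group "module_mat TYPE(real) d d" by (rule abelian_group_mat)
  {
    case empty
    have "0\<^sub>m d d *\<^sub>v s = 0\<^sub>v d" using empty by (intro eq_vecI) auto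
    then show ?case using finsum_empty empty by (simp add: module_mat_simps)
  next
    case (insert j S)
    let ?T = "\<Oplus>\<^bsub>module_mat TYPE(real) d d\<^esub>j\<in>S. Q j"
    have Q: "Q \<in> S \<rightarrow> carrier (module_mat TYPE(real) d d)" "Q j \<in> carrier (module_mat TYPE(real) d d)"
      using insert.prems by (auto simp: module_mat_simps)
    have T: "?T \<in> carrier_mat d d" "s \<bullet> (?T *\<^sub>v s) = (\<Sum>j\<in>S. s \<bullet> (Q j *\<^sub>v s))"
      using insert.IH insert.prems by auto
    have Qj: "Q j \<in> carrier_mat d d" using insert.prems by simp
    have "s \<bullet> ((Q j + ?T) *\<^sub>v s) = s \<bullet> (Q j *\<^sub>v s) + s \<bullet> (?T *\<^sub>v s)"
      using Qj T(1) insert.prems(2)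
      by (simp add: add_mult_distrib_mat_vec[OF Qj T(1)] scalar_prod_add_distrib[of _ d])
    then show ?case
      using finsum_insert[OF insert.hyps Q] T Qj insert.hyps by (simp add: module_mat_simps)
  }
qed

text \<open>A nonzero kernel vector \<open>v\<close> would give
  \<open>v \<bullet> (P *\<^sub>v v) = 0\<close>, against positive definiteness. So the determinant
  is nonzero, \<open>mat_inverse P\<close> is not \<open>None\<close>, and \<open>the\<close>
  selects a genuine inverse.\<close>

lemma pos_def_mat_inverse:
  assumes P: "P \<in> carrier_mat p p" "pos_def_mat P"
  shows "the (mat_inverse P) \<in> carrier_mat p p" "the (mat_inverse P) * P = 1\<^sub>m p"
proof -
  have "det P \<noteq> 0"
  proof
    assume "det P = 0"
    then obtain v where v: "v \<in> carrier_vec p" "v \<noteq> 0\<^sub>v p" "P *\<^sub>v v = 0\<^sub>v p"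
      using det_0_iff_vec_prod_zero_field[OF P(1)] by blast
    have "0 < v \<bullet> (P *\<^sub>v v)"
      using P v(1,2) unfolding pos_def_mat_def by (auto simp del: scalar_prod_right_zero)
    then show False using v by simp
  qed
  \<comment> \<open>The argument \<open>()\<close> fills the record extension of the matrix ring, so
    that both facts speak about the same group of units.\<close>
  then have "mat_inverse P \<noteq> None"
    using mat_inverse(1)[OF P(1), of "()"] det_non_zero_imp_unit[OF P(1), of "()"] by blast
  then obtain R where "mat_inverse P = Some R" by blast
  then show "the (mat_inverse P) \<in> carrier_mat p p" "the (mat_inverse P) * P = 1\<^sub>m p"
    using mat_inverse(2)[OF P(1)] by auto
qed

section \<open>Stacked vectors\<close>

text \<open>Blocks with the same index have the same length, so both stacks are cut at the same
  positions. The induction runs over arbitrary lists of indices from \<open>S\<close>; distinctness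
  of the sorted list enters only in passing from a list sum to a sum over \<open>S\<close>.\<close>

lemma stack_scalar_prod:
  fixes x y :: "nat \<Rightarrow> 'a::comm_semiring_0 vec"
  assumes "finite S" "\<And>j. j \<in> S \<Longrightarrow> x j \<in> carrier_vec (n j)"
    "\<And>j. j \<in> S \<Longrightarrow> y j \<in> carrier_vec (n j)"
  shows "stack x S \<bullet> stack y S = (\<Sum>j\<in>S. x j \<bullet> y j)"
proof -
  have "foldr (\<lambda>j v. x j @\<^sub>v v) js vNil \<bullet> foldr (\<lambda>j v. y j @\<^sub>v v) js vNil = (\<Sum>j\<leftarrow>js. x j \<bullet> y j)"
    if "set js \<subseteq> S" for js
    using that
  proof (induction js)
    case Nil
    then show ?case by (simp add: scalar_prod_def)
  next
    case (Cons j js)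
    \<comment> \<open>Stated as equations between mapped lists, these rewrite both tail lengths to
      the same sum of \<open>n\<close>; \<open>map_eq_conv\<close> is removed below to keep them in
      this form.\<close>
    have d: "map (\<lambda>k. dim_vec (x k)) js = map n js" "map (\<lambda>k. dim_vec (y k)) js = map n js"
      using Cons.prems assms(2,3) by auto
    have c: "x j \<in> carrier_vec (n j)" "y j \<in> carrier_vec (n j)"
      "foldr (\<lambda>j v. x j @\<^sub>v v) js vNil \<in> carrier_vec (\<Sum>j\<leftarrow>js. n j)"
      "foldr (\<lambda>j v. y j @\<^sub>v v) js vNil \<in> carrier_vec (\<Sum>j\<leftarrow>js. n j)"
      using Cons.prems assms(2,3) d
      by (auto intro!: carrier_vecI simp: dim_foldr_append_vec simp del: map_eq_conv)
    show ?case
      using Cons.IH Cons.prems scalar_prod_append[OF c(1,3) c(2,4)] by simp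
  qed
  from this[of "sorted_list_of_set S"] show ?thesis
    unfolding stack_def using assms(1)
    by (simp add: sum_list_distinct_conv_sum_set[of "sorted_list_of_set S"])
qed

lemma stack_add:
  fixes x y :: "nat \<Rightarrow> 'a::plus vec"
  assumes "finite S" "\<And>j. j \<in> S \<Longrightarrow> x j \<in> carrier_vec (n j)"
    "\<And>j. j \<in> S \<Longrightarrow> y j \<in> carrier_vec (n j)"
  shows "stack (\<lambda>j. x j + y j) S = stack x S + stack y S"
proof -
  have "foldr (\<lambda>j v. (x j + y j) @\<^sub>v v) js vNil
      = foldr (\<lambda>j v. x j @\<^sub>v v) js vNil + foldr (\<lambda>j v. y j @\<^sub>v v) js vNil"
    if "set js \<subseteq> S" for js
    using that
  proof (induction js)
    case Nil
    show ?case by (rule eq_vecI) auto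
  next
    case (Cons j js)
    have d: "map (\<lambda>k. dim_vec (x k)) js = map n js" "map (\<lambda>k. dim_vec (y k)) js = map n js"
      using Cons.prems assms(2,3) by auto
    have c: "x j \<in> carrier_vec (n j)" "y j \<in> carrier_vec (n j)"
      "foldr (\<lambda>j v. x j @\<^sub>v v) js vNil \<in> carrier_vec (\<Sum>j\<leftarrow>js. n j)"
      "foldr (\<lambda>j v. y j @\<^sub>v v) js vNil \<in> carrier_vec (\<Sum>j\<leftarrow>js. n j)"
      using Cons.prems assms(2,3) d
      by (auto intro!: carrier_vecI simp: dim_foldr_append_vec simp del: map_eq_conv)
    show ?case
      using Cons.IH Cons.prems append_vec_add[OF c(1,2) c(3,4)] by simp
  qed
  from this[of "sorted_list_of_set S"] show ?thesis
    unfolding stack_def using assms(1) by simp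
qed

lemma stack_cong:
  assumes "\<And>j. j \<in> S \<Longrightarrow> x j = y j"
  shows "stack x S = stack y S"
proof (cases "finite S")
  case True
  then show ?thesis unfolding stack_def using assms by (intro foldr_cong) auto
\<comment> \<open>For infinite \<open>S\<close> the sorted list is empty by convention, and both
  stacks are \<open>vNil\<close>.\<close>
qed (simp add: stack_def)

section \<open>Selection matrices and the lifted blocks \<open>P_nbr\<close>\<close>

lemma U_mat_carrier [simp]: "U_mat M n j \<in> carrier_mat (n j) (stacked_dim n {1..M})"
  by (simp add: U_mat_def)

lemma W_mat_carrier [simp]:
  assumes "finite S"
  shows "W_mat M n S \<in> carrier_mat (stacked_dim n S) (stacked_dim n {1..M})"
proof -
  have "foldr (\<lambda>j X. U_mat M n j @\<^sub>r X) js (0\<^sub>m 0 (stacked_dim n {1..M}))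
      \<in> carrier_mat (\<Sum>j\<leftarrow>js. n j) (stacked_dim n {1..M})" for js
    by (induction js) auto
  from this[of "sorted_list_of_set S"] show ?thesis
    unfolding W_mat_def stacked_dim_def[of n S] using assms
    by (simp add: sum_list_distinct_conv_sum_set[of "sorted_list_of_set S"])
qed

text \<open>\<open>W_mat\<close> restricts a global vector to the blocks in \<open>S\<close>, so its
  transpose is the adjoint operation, extension by zero.\<close>

lemma transpose_W_mat_stack:
  assumes S: "S \<subseteq> {1..M}" and s: "\<And>j. j \<in> S \<Longrightarrow> s j \<in> carrier_vec (n j)"
  shows "transpose_mat (W_mat M n S) *\<^sub>v stack s S
    = stack (\<lambda>j. if j \<in> S then s j else 0\<^sub>v (n j)) {1..M}" (is "?l = stack ?s0 _")
proof (rule eq_vec_scalar_prodI)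
  have fin: "finite S" using S finite_subset by blast
  have W: "W_mat M n S \<in> carrier_mat (stacked_dim n S) (stacked_dim n {1..M})" using fin by simp
  have st: "stack s S \<in> carrier_vec (stacked_dim n S)" using fin s by (intro dim_stack) auto
  have s0: "?s0 j \<in> carrier_vec (n j)" for j using s by simp
  show "?l \<in> carrier_vec (stacked_dim n {1..M})"
    using W st by (intro mult_mat_vec_carrier[of _ _ "stacked_dim n S"]) auto
  show "stack ?s0 {1..M} \<in> carrier_vec (stacked_dim n {1..M})" using s0 by (intro dim_stack) auto
  fix u :: "real vec" assume u: "u \<in> carrier_vec (stacked_dim n {1..M})"
  \<comment> \<open>Every test vector is itself a stack, so \<open>W_mat_stack\<close> describes the
    effect of the selection on it.\<close>
  obtain x where x: "\<And>j. j \<in> {1..M} \<Longrightarrow> x j \<in> carrier_vec (n j)" "u = stack x {1..M}"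
    using stack_exhaust[OF _ u] by blast
  have "?l \<bullet> u = stack s S \<bullet> stack x S"
    using transpose_vec_mult_scalar[OF W u st] W_mat_stack[OF S x(1)] x(2) by simp
  also have "\<dots> = (\<Sum>j\<in>S. s j \<bullet> x j)" using fin s x(1) S by (intro stack_scalar_prod) auto
  \<comment> \<open>The added summands vanish, since \<open>?s0 j\<close> is the zero vector outside
    \<open>S\<close>.\<close>
  also have "\<dots> = (\<Sum>j\<in>{1..M}. ?s0 j \<bullet> x j)"
    using S x(1) by (intro sum.mono_neutral_cong_left) auto
  also have "\<dots> = stack ?s0 {1..M} \<bullet> u"
    unfolding x(2) using s x(1) by (intro stack_scalar_prod[symmetric]) auto
  finally show "?l \<bullet> u = stack ?s0 {1..M} \<bullet> u" .
qed

lemma P_nbr_carrier: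
  assumes S: "S \<subseteq> {1..M}" and j: "j \<in> S" and P: "P j \<in> carrier_mat (n j) (n j)"
  shows "P_nbr M n P S j \<in> carrier_mat (stacked_dim n S) (stacked_dim n S)"
proof -
  have W: "W_mat M n S \<in> carrier_mat (stacked_dim n S) (stacked_dim n {1..M})"
    using finite_subset[OF S] by simp
  have U: "U_mat M n j \<in> carrier_mat (n j) (stacked_dim n {1..M})" by simp
  show ?thesis unfolding P_nbr_def using W U P
    by (meson mult_carrier_mat transpose_carrier_mat)
qed

text \<open>Let \<open>T\<close> be the product of \<open>U_mat M n j\<close> and the transpose of
  \<open>W_mat M n S\<close>. Then \<open>P_nbr\<close> is the pullback of the form
  \<open>P j\<close> along \<open>T\<close>, and \<open>T\<close> extends by zero and extracts block
  \<open>j\<close>, which is \<open>s j\<close> because \<open>j\<close> lies in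
  \<open>S\<close>.\<close>

lemma P_nbr_quadratic_form:
  assumes S: "S \<subseteq> {1..M}" and j: "j \<in> S" and P: "P j \<in> carrier_mat (n j) (n j)"
    and s: "\<And>j. j \<in> S \<Longrightarrow> s j \<in> carrier_vec (n j)"
  shows "stack s S \<bullet> (P_nbr M n P S j *\<^sub>v stack s S) = s j \<bullet> (P j *\<^sub>v s j)"
proof -
  let ?d = "stacked_dim n S" and ?D = "stacked_dim n {1..M}"
  let ?W = "W_mat M n S" and ?U = "U_mat M n j"
  let ?s0 = "\<lambda>j. if j \<in> S then s j else 0\<^sub>v (n j)"
  have fin: "finite S" using S finite_subset by blast
  have W: "?W \<in> carrier_mat ?d ?D" using fin by simp
  have Wt: "transpose_mat ?W \<in> carrier_mat ?D ?d" using W by simp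
  have U: "?U \<in> carrier_mat (n j) ?D" by simp
  have Ut: "transpose_mat ?U \<in> carrier_mat ?D (n j)" using U by simp
  have st: "stack s S \<in> carrier_vec ?d" using fin s by (intro dim_stack) auto
  have UW: "?U *\<^sub>v (transpose_mat ?W *\<^sub>v stack s S) = s j"
    using U_mat_stack[of j M ?s0 n] S j s by (auto simp: transpose_W_mat_stack[OF S s])
  have sj: "s j \<in> carrier_vec (n j)" using j s by simp
  have WU: "?W * transpose_mat ?U \<in> carrier_mat ?d (n j)" using W Ut by (rule mult_carrier_mat)
  have WUP: "?W * transpose_mat ?U * P j \<in> carrier_mat ?d (n j)"
    using WU P by (rule mult_carrier_mat)
  have WUPU: "?W * transpose_mat ?U * P j * ?U \<in> carrier_mat ?d ?D"
    using WUP U by (rule mult_carrier_mat)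
  have Wts: "transpose_mat ?W *\<^sub>v stack s S \<in> carrier_vec ?D"
    using Wt st by (rule mult_mat_vec_carrier)
  have UWts: "?U *\<^sub>v (transpose_mat ?W *\<^sub>v stack s S) \<in> carrier_vec (n j)"
    using U Wts by (rule mult_mat_vec_carrier)
  have PUWts: "P j *\<^sub>v (?U *\<^sub>v (transpose_mat ?W *\<^sub>v stack s S)) \<in> carrier_vec (n j)"
    using P UWts by (rule mult_mat_vec_carrier)
  have Ps: "P j *\<^sub>v s j \<in> carrier_vec (n j)" using P sj by simp
  have UtPs: "transpose_mat ?U *\<^sub>v (P j *\<^sub>v s j) \<in> carrier_vec ?D"
    using Ut Ps by (rule mult_mat_vec_carrier)
  have "P_nbr M n P S j *\<^sub>v stack s S
      = ?W *\<^sub>v (transpose_mat ?U *\<^sub>v (P j *\<^sub>v (?U *\<^sub>v (transpose_mat ?W *\<^sub>v stack s S))))"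
    unfolding P_nbr_def using Wt
    by (simp only: assoc_mult_mat_vec[OF WUPU Wt st] assoc_mult_mat_vec[OF WUP U Wts]
        assoc_mult_mat_vec[OF WU P UWts] assoc_mult_mat_vec[OF W Ut PUWts])
  also have "\<dots> = ?W *\<^sub>v (transpose_mat ?U *\<^sub>v (P j *\<^sub>v s j))" by (simp only: UW)
  finally have "stack s S \<bullet> (P_nbr M n P S j *\<^sub>v stack s S)
      = stack s S \<bullet> (?W *\<^sub>v (transpose_mat ?U *\<^sub>v (P j *\<^sub>v s j)))" by simp
  also have "\<dots> = (transpose_mat ?W *\<^sub>v stack s S) \<bullet> (transpose_mat ?U *\<^sub>v (P j *\<^sub>v s j))"
    by (rule transpose_vec_mult_scalar[OF W UtPs st, symmetric])
  also have "\<dots> = (transpose_mat ?U *\<^sub>v (P j *\<^sub>v s j)) \<bullet> (transpose_mat ?W *\<^sub>v stack s S)"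
    by (rule comm_scalar_prod[OF Wts UtPs])
  also have "\<dots> = (P j *\<^sub>v s j) \<bullet> s j"
    using transpose_vec_mult_scalar[OF U Wts Ps] by (simp only: UW)
  also have "\<dots> = s j \<bullet> (P j *\<^sub>v s j)" using sj Ps by (intro comm_scalar_prod)
  finally show ?thesis .
qed

section \<open>The diagonal matrix of sizes and its square root\<close>

text \<open>An arbitrary index list permits induction, and an arbitrary coefficient function lets
  one notion cover \<open>alpha_mat\<close>, its restriction to the neighbours and the entrywise
  square root.\<close>

definition scalar_blocks :: "(nat \<Rightarrow> nat) \<Rightarrow> (nat \<Rightarrow> 'a::semiring_1) \<Rightarrow> nat list \<Rightarrow> 'a mat" where
  "scalar_blocks n \<beta> js = diag_block_mat (map (\<lambda>j. \<beta> j \<cdot>\<^sub>m 1\<^sub>m (n j)) js)"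

lemma scalar_blocks_carrier [simp]:
  "scalar_blocks n \<beta> js \<in> carrier_mat (\<Sum>j\<leftarrow>js. n j) (\<Sum>j\<leftarrow>js. n j)"
  unfolding scalar_blocks_def
  by (rule carrier_matI) (simp_all add: dim_diag_block_mat comp_def)

lemma scalar_blocks_Cons:
  "scalar_blocks n \<beta> (j # js) = four_block_mat (\<beta> j \<cdot>\<^sub>m 1\<^sub>m (n j)) (0\<^sub>m (n j) (\<Sum>j\<leftarrow>js. n j))
     (0\<^sub>m (\<Sum>j\<leftarrow>js. n j) (n j)) (scalar_blocks n \<beta> js)"
  using scalar_blocks_carrier[of n \<beta> js] by (simp add: scalar_blocks_def Let_def)

lemma scalar_blocks_mult_stack:
  fixes s :: "nat \<Rightarrow> 'a::comm_ring_1 vec"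
  assumes "finite S" "\<And>j. j \<in> S \<Longrightarrow> s j \<in> carrier_vec (n j)"
  shows "scalar_blocks n \<beta> (sorted_list_of_set S) *\<^sub>v stack s S = stack (\<lambda>j. \<beta> j \<cdot>\<^sub>v s j) S"
proof -
  have "scalar_blocks n \<beta> js *\<^sub>v foldr (\<lambda>j v. s j @\<^sub>v v) js vNil
      = foldr (\<lambda>j v. (\<beta> j \<cdot>\<^sub>v s j) @\<^sub>v v) js vNil" if "set js \<subseteq> S" for js
    using that
  proof (induction js)
    case Nil
    show ?case by (rule eq_vecI) (auto simp: scalar_blocks_def)
  next
    case (Cons j js)
    have sj: "s j \<in> carrier_vec (n j)" using Cons.prems assms(2) by simp
    have "map (\<lambda>k. dim_vec (s k)) js = map n js"
      using Cons.prems assms(2) by auto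
    then have "(\<Sum>k\<leftarrow>js. dim_vec (s k)) = (\<Sum>k\<leftarrow>js. n k)" by (simp only:)
    then have v: "foldr (\<lambda>j v. s j @\<^sub>v v) js vNil \<in> carrier_vec (\<Sum>j\<leftarrow>js. n j)"
      by (intro carrier_vecI) (simp add: dim_foldr_append_vec)
    have "\<beta> j \<cdot>\<^sub>m 1\<^sub>m (n j) *\<^sub>v s j = \<beta> j \<cdot>\<^sub>v s j"
      using sj by (intro eq_vecI) auto
    then show ?case
      using Cons sj v unfolding scalar_blocks_Cons
      by (simp add: mult_mat_vec_split[of _ "n j" _ "\<Sum>j\<leftarrow>js. n j"])
  qed
  from this[of "sorted_list_of_set S"] show ?thesis
    unfolding stack_def using assms(1) by simp
qed

text \<open>Off the diagonal this rests on \<open>sqrt 0 = 0\<close>, which keeps the zero entries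
  zero.\<close>

lemma map_mat_sqrt_scalar_blocks:
  "map_mat sqrt (scalar_blocks n \<beta> js) = scalar_blocks n (\<lambda>j. sqrt (\<beta> j)) js"
proof (induction js)
  case Nil
  show ?case by (rule eq_matI) (auto simp: scalar_blocks_def)
next
  case (Cons j js)
  have "map_mat sqrt (\<beta> j \<cdot>\<^sub>m 1\<^sub>m (n j)) = sqrt (\<beta> j) \<cdot>\<^sub>m 1\<^sub>m (n j)"
    "map_mat sqrt (0\<^sub>m a b) = 0\<^sub>m a b" for a b
    by (auto intro!: eq_matI)
  then show ?case
    using Cons scalar_blocks_carrier[of n \<beta> js] unfolding scalar_blocks_Cons
    by (subst map_four_block_mat[of _ "n j" "n j" _ "\<Sum>j\<leftarrow>js. n j" _ "\<Sum>j\<leftarrow>js. n j"]) auto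
qed

text \<open>The square root is taken entrywise, so the diagonal shape of the matrix has to be
  identified first; it is enough to compare the actions on stacked vectors.\<close>

lemma alpha_nbr_eq:
  assumes S: "S \<subseteq> {1..M}"
  shows "alpha_nbr M n \<alpha> S = scalar_blocks n \<alpha> (sorted_list_of_set S)"
proof (rule eq_mat_mult_vecI)
  let ?d = "stacked_dim n S" and ?D = "stacked_dim n {1..M}"
  let ?W = "W_mat M n S" and ?a = "alpha_mat M n \<alpha>"
  have fin: "finite S" using S finite_subset by blast
  have a: "?a = scalar_blocks n \<alpha> (sorted_list_of_set {1..M})"
    by (simp add: alpha_mat_def scalar_blocks_def)
  have dim: "scalar_blocks n \<alpha> (sorted_list_of_set T)
      \<in> carrier_mat (stacked_dim n T) (stacked_dim n T)" if "finite T" for T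
    using scalar_blocks_carrier[of n \<alpha> "sorted_list_of_set T"] that
    by (simp add: stacked_dim_def sum_list_distinct_conv_sum_set[of "sorted_list_of_set T"])
  have ac: "?a \<in> carrier_mat ?D ?D" unfolding a by (intro dim) simp
  have W: "?W \<in> carrier_mat ?d ?D" using fin by simp
  have Wt: "transpose_mat ?W \<in> carrier_mat ?D ?d" using W by simp
  show "alpha_nbr M n \<alpha> S \<in> carrier_mat ?d ?d"
    unfolding alpha_nbr_def using W ac by (meson mult_carrier_mat transpose_carrier_mat)
  show "scalar_blocks n \<alpha> (sorted_list_of_set S) \<in> carrier_mat ?d ?d" using dim fin .
  fix v :: "real vec" assume v: "v \<in> carrier_vec ?d"
  obtain s where s: "\<And>j. j \<in> S \<Longrightarrow> s j \<in> carrier_vec (n j)" and vs: "v = stack s S"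
    using stack_exhaust[OF fin v] by blast
  let ?s0 = "\<lambda>j. if j \<in> S then s j else 0\<^sub>v (n j)"
  have s0: "?s0 j \<in> carrier_vec (n j)" for j using s by simp
  \<comment> \<open>The three factors act in turn: extend by zero, scale every block, restrict to
    \<open>S\<close>. The restriction discards the padding.\<close>
  have "alpha_nbr M n \<alpha> S *\<^sub>v v = ?W *\<^sub>v (?a *\<^sub>v (transpose_mat ?W *\<^sub>v v))"
    unfolding alpha_nbr_def using W Wt ac v
    by (simp add: assoc_mult_mat_vec[of _ ?d ?D _ ?d] assoc_mult_mat_vec[of _ ?d ?D _ ?D])
  also have "transpose_mat ?W *\<^sub>v v = stack ?s0 {1..M}"
    unfolding vs by (rule transpose_W_mat_stack[OF S s])
  also have "?a *\<^sub>v \<dots> = stack (\<lambda>j. \<alpha> j \<cdot>\<^sub>v ?s0 j) {1..M}"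
    unfolding a using s0 by (intro scalar_blocks_mult_stack) auto
  also have "?W *\<^sub>v \<dots> = stack (\<lambda>j. \<alpha> j \<cdot>\<^sub>v ?s0 j) S"
    using S s0 by (intro W_mat_stack) auto
  also have "\<dots> = stack (\<lambda>j. \<alpha> j \<cdot>\<^sub>v s j) S" by (intro stack_cong) simp
  also have "\<dots> = scalar_blocks n \<alpha> (sorted_list_of_set S) *\<^sub>v v"
    unfolding vs using fin s by (intro scalar_blocks_mult_stack[symmetric]) auto
  finally show "alpha_nbr M n \<alpha> S *\<^sub>v v = scalar_blocks n \<alpha> (sorted_list_of_set S) *\<^sub>v v" .
qed

lemma sqrt_alpha_nbr:
  assumes S: "S \<subseteq> {1..M}"
  shows "map_mat sqrt (alpha_nbr M n \<alpha> S) \<in> carrier_mat (stacked_dim n S) (stacked_dim n S)"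
    and "(\<And>j. j \<in> S \<Longrightarrow> s j \<in> carrier_vec (n j)) \<Longrightarrow>
      map_mat sqrt (alpha_nbr M n \<alpha> S) *\<^sub>v stack s S = stack (\<lambda>j. sqrt (\<alpha> j) \<cdot>\<^sub>v s j) S"
proof -
  have fin: "finite S" using S finite_subset by blast
  have eq: "map_mat sqrt (alpha_nbr M n \<alpha> S)
      = scalar_blocks n (\<lambda>j. sqrt (\<alpha> j)) (sorted_list_of_set S)"
    unfolding alpha_nbr_eq[OF S] by (rule map_mat_sqrt_scalar_blocks)
  show "map_mat sqrt (alpha_nbr M n \<alpha> S) \<in> carrier_mat (stacked_dim n S) (stacked_dim n S)"
    unfolding eq using fin scalar_blocks_carrier[of n "\<lambda>j. sqrt (\<alpha> j)" "sorted_list_of_set S"]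
    by (simp add: stacked_dim_def sum_list_distinct_conv_sum_set[of "sorted_list_of_set S"])
  assume "\<And>j. j \<in> S \<Longrightarrow> s j \<in> carrier_vec (n j)"
  then show "map_mat sqrt (alpha_nbr M n \<alpha> S) *\<^sub>v stack s S = stack (\<lambda>j. sqrt (\<alpha> j) \<cdot>\<^sub>v s j) S"
    unfolding eq using fin by (intro scalar_blocks_mult_stack)
qed

section \<open>Normalised ellipsoids and the Schur complement bound\<close>

lemma quadratic_form_smult:
  fixes Q :: "real mat"
  assumes "Q \<in> carrier_mat p p" "v \<in> carrier_vec p"
  shows "(t \<cdot>\<^sub>v v) \<bullet> (Q *\<^sub>v (t \<cdot>\<^sub>v v)) = t\<^sup>2 * (v \<bullet> (Q *\<^sub>v v))"
  using assms by (simp add: mult_mat_vec[of Q p p] power2_eq_square)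

text \<open>Dividing the displacement from the centre by \<open>sqrt \<alpha>\<close> normalises the
  bound to 1. For \<open>\<alpha> = 0\<close> positive definiteness collapses the ellipsoid to its
  centre.\<close>

lemma ellipsoid_parametrization:
  assumes P: "P \<in> carrier_mat p p" "pos_def_mat P"
    and x: "x \<in> carrier_vec p" and c: "c \<in> carrier_vec p" and "0 \<le> \<alpha>"
    and le: "(x - c) \<bullet> (P *\<^sub>v (x - c)) \<le> \<alpha>"
  obtains s where "s \<in> carrier_vec p" "x = c + sqrt \<alpha> \<cdot>\<^sub>v s" "s \<bullet> (P *\<^sub>v s) \<le> 1"
proof (cases "\<alpha> = 0")
  case True
  have "x - c = 0\<^sub>v p"
  proof (rule ccontr)
    assume "x - c \<noteq> 0\<^sub>v p"
    then have "0 < (x - c) \<bullet> (P *\<^sub>v (x - c))"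
      using P x c unfolding pos_def_mat_def by auto
    then show False using le True by simp
  qed
  then have "(x - c) $ r = 0" if "r < p" for r using that by simp
  then have "x = c" using x c by (intro eq_vecI) auto
  \<comment> \<open>With \<open>sqrt \<alpha> = 0\<close> the parameter is constrained only by the
    bound 1, which the zero vector meets.\<close>
  then show ?thesis using P c True by (intro that[of "0\<^sub>v p"]) auto
next
  case False
  then have pos: "0 < \<alpha>" using \<open>0 \<le> \<alpha>\<close> by simp
  let ?s = "(1 / sqrt \<alpha>) \<cdot>\<^sub>v (x - c)"
  show ?thesis
  proof (rule that)
    show "?s \<in> carrier_vec p" using x c by simp
    show "x = c + sqrt \<alpha> \<cdot>\<^sub>v ?s" using x c pos by (intro eq_vecI) auto
    have "?s \<bullet> (P *\<^sub>v ?s) = (1 / sqrt \<alpha>)\<^sup>2 * ((x - c) \<bullet> (P *\<^sub>v (x - c)))"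
      using P x c by (intro quadratic_form_smult) auto
    then show "?s \<bullet> (P *\<^sub>v ?s) \<le> 1" using le pos by (simp add: power_divide)
  qed
qed

text \<open>Minimising the quadratic function over \<open>w\<close> gives \<open>w = - (1 / a) \<cdot>\<^sub>v (P *\<^sub>v y)\<close>,
  except for \<open>a = 0\<close>, where it is affine in \<open>w\<close> and \<open>w = - (P *\<^sub>v y)\<close> will do.\<close>

lemma quadratic_form_le_of_schur:
  assumes P: "P \<in> carrier_mat p p" "pos_def_mat P" and y: "y \<in> carrier_vec p" and a: "0 \<le> a"
    and nonneg: "\<And>w. w \<in> carrier_vec p \<Longrightarrow>
      0 \<le> a * (w \<bullet> (the (mat_inverse P) *\<^sub>v w)) + 2 * (w \<bullet> y) + a"
  shows "y \<bullet> (P *\<^sub>v y) \<le> a\<^sup>2"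
proof -
  let ?R = "the (mat_inverse P)" and ?q = "y \<bullet> (P *\<^sub>v y)"
  note R = pos_def_mat_inverse[OF P]
  have Py: "P *\<^sub>v y \<in> carrier_vec p" using P y by simp
  have "?R *\<^sub>v (P *\<^sub>v y) = y"
    using assoc_mult_mat_vec[OF R(1) P(1) y] R(2) y by simp
  then have qR: "(P *\<^sub>v y) \<bullet> (?R *\<^sub>v (P *\<^sub>v y)) = ?q"
    using comm_scalar_prod[OF Py y] by simp
  \<comment> \<open>Along the line spanned by \<open>P *\<^sub>v y\<close> the hypothesis becomes a
    scalar quadratic in \<open>t\<close>: the inverse undoes \<open>P\<close>, and both products
    reduce to multiples of \<open>?q\<close>.\<close>
  have key: "0 \<le> a * (t\<^sup>2 * ?q) + 2 * (t * ?q) + a" for t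
  proof -
    have "(t \<cdot>\<^sub>v (P *\<^sub>v y)) \<bullet> y = t * ?q" using Py y comm_scalar_prod[OF Py y] by simp
    then show ?thesis
      using nonneg[of "t \<cdot>\<^sub>v (P *\<^sub>v y)"] Py quadratic_form_smult[OF R(1) Py, of t] qR by simp
  qed
  show ?thesis
  proof (cases "a = 0")
    case True
    \<comment> \<open>At \<open>t = -1\<close> the inequality reads
      \<open>0 \<le> - 2 * ?q\<close>.\<close>
    then show ?thesis using key[of "-1"] by simp
  next
    case False
    then have "0 < a" using a by simp
    \<comment> \<open>At \<open>t = - 1 / a\<close> the quadratic term is \<open>?q / a\<close> and
      the linear term is \<open>- 2 * ?q / a\<close>.\<close>
    then have "0 \<le> - ?q / a + a" using key[of "- 1 / a"]
      by (simp add: power2_eq_square field_simps)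
    then show ?thesis using \<open>0 < a\<close> by (simp add: field_simps power2_eq_square)
  qed
qed

section \<open>Invariance of the terminal set by the S-procedure\<close>

theorem proposition2:
  fixes M :: nat and n m :: "nat \<Rightarrow> nat" and \<N> :: "nat \<Rightarrow> nat set"
    and A B K P :: "nat \<Rightarrow> real mat"
    and c :: "nat \<Rightarrow> real vec" and \<alpha> :: "nat \<Rightarrow> real" and i :: nat
  assumes neighbors: "\<And>j. j \<in> {1..M} \<Longrightarrow> \<N> j \<subseteq> {1..M} \<and> j \<in> \<N> j"
    and A: "\<And>j. j \<in> {1..M} \<Longrightarrow> A j \<in> carrier_mat (n j) (stacked_dim n (\<N> j))"
    and B: "\<And>j. j \<in> {1..M} \<Longrightarrow> B j \<in> carrier_mat (n j) (m j)"
    and K: "\<And>j. j \<in> {1..M} \<Longrightarrow> K j \<in> carrier_mat (m j) (stacked_dim n (\<N> j))"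
    and P: "\<And>j. j \<in> {1..M} \<Longrightarrow> P j \<in> carrier_mat (n j) (n j) \<and> pos_def_mat (P j)"
    and c: "\<And>j. j \<in> {1..M} \<Longrightarrow> c j \<in> carrier_vec (n j)"
    and \<alpha>: "\<And>j. j \<in> {1..M} \<Longrightarrow> 0 \<le> \<alpha> j"
    and i: "i \<in> {1..M}"
    and lmi: "\<exists>l. (\<forall>j\<in>\<N> i. 0 \<le> l j) \<and>
      pos_semidef_mat (invariance_lmi M n P c \<alpha> (\<N> i) i (A i + B i * K i) l)"
  shows "\<forall>xN \<in> carrier_vec (stacked_dim n (\<N> i)). \<forall>x.
    xN = stack x (\<N> i) \<and>
    (\<forall>j\<in>\<N> i. x j \<in> carrier_vec (n j) \<and> (x j - c j) \<bullet> (P j *\<^sub>v (x j - c j)) \<le> \<alpha> j) \<longrightarrow>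
    ((A i + B i * K i) *\<^sub>v xN - c i) \<bullet> (P i *\<^sub>v ((A i + B i * K i) *\<^sub>v xN - c i)) \<le> \<alpha> i"
proof (intro ballI allI impI)
  fix xN :: "real vec" and x :: "nat \<Rightarrow> real vec"
  let ?S = "\<N> i" and ?F = "A i + B i * K i"
  let ?d = "stacked_dim n ?S" and ?p = "n i"
  assume hyp: "xN = stack x ?S \<and>
    (\<forall>j\<in>?S. x j \<in> carrier_vec (n j) \<and> (x j - c j) \<bullet> (P j *\<^sub>v (x j - c j)) \<le> \<alpha> j)"
  have S: "?S \<subseteq> {1..M}" using neighbors[OF i] by simp
  have fin: "finite ?S" using S finite_subset by blast
  have F: "?F \<in> carrier_mat ?p ?d" using A[OF i] B[OF i] K[OF i] by simp
  have Pi: "P i \<in> carrier_mat ?p ?p" "pos_def_mat (P i)" using P[OF i] by auto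
  obtain l where l: "\<forall>j\<in>?S. 0 \<le> l j"
    and psd: "pos_semidef_mat (invariance_lmi M n P c \<alpha> ?S i ?F l)"
    using lmi by blast
  \<comment> \<open>Each neighbour state is expressed through a point of the unit ellipsoid of
    \<open>P j\<close>; these points are then chosen for all neighbours at once, so that they can be
    stacked.\<close>
  have "\<exists>s. s \<in> carrier_vec (n j) \<and> x j = c j + sqrt (\<alpha> j) \<cdot>\<^sub>v s \<and> s \<bullet> (P j *\<^sub>v s) \<le> 1"
    if "j \<in> ?S" for j
  proof -
    have "j \<in> {1..M}" using that S by blast
    then show ?thesis
      using ellipsoid_parametrization[of "P j" "n j" "x j" "c j" "\<alpha> j"] P c \<alpha> hyp that by metis
  qed
  then obtain s where s: "\<And>j. j \<in> ?S \<Longrightarrow> s j \<in> carrier_vec (n j)"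
    and xs: "\<And>j. j \<in> ?S \<Longrightarrow> x j = c j + sqrt (\<alpha> j) \<cdot>\<^sub>v s j"
    and s1: "\<And>j. j \<in> ?S \<Longrightarrow> s j \<bullet> (P j *\<^sub>v s j) \<le> 1"
    by metis
  have cS: "c j \<in> carrier_vec (n j)" if "j \<in> ?S" for j using that S c by blast
  define D where "D = map_mat sqrt (alpha_nbr M n \<alpha> ?S)"
  define h where "h = ?F *\<^sub>v c_nbr M n c ?S - c i"
  define Q where "Q = (\<Oplus>\<^bsub>module_mat TYPE(real) ?d ?d\<^esub>j\<in>?S. l j \<cdot>\<^sub>m P_nbr M n P ?S j)"
  define y where "y = ?F *\<^sub>v xN - c i"
  have D: "D \<in> carrier_mat ?d ?d" "D *\<^sub>v stack s ?S = stack (\<lambda>j. sqrt (\<alpha> j) \<cdot>\<^sub>v s j) ?S"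
    unfolding D_def using sqrt_alpha_nbr[OF S] s by auto
  have st: "stack s ?S \<in> carrier_vec ?d" using fin s by (intro dim_stack) auto
  have cN: "c_nbr M n c ?S = stack c ?S" unfolding c_nbr_def using S c by (intro W_mat_stack) auto
  have cc: "stack c ?S \<in> carrier_vec ?d" using fin cS by (intro dim_stack) auto
  \<comment> \<open>The diagonal matrix \<open>D\<close> turns the stacked unit parameters into the
    displacement from the stacked centres.\<close>
  have xN: "xN = stack c ?S + D *\<^sub>v stack s ?S"
  proof -
    have "xN = stack (\<lambda>j. c j + sqrt (\<alpha> j) \<cdot>\<^sub>v s j) ?S" 
      using hyp stack_cong[of ?S x] xs by simp
    also have "\<dots> = stack c ?S + stack (\<lambda>j. sqrt (\<alpha> j) \<cdot>\<^sub>v s j) ?S"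
      using fin cS s by (intro stack_add) auto
    finally show ?thesis using D(2) by simp
  qed
  have G: "?F * D \<in> carrier_mat ?p ?d" using F D(1) by simp
  have h: "h \<in> carrier_vec ?p" unfolding h_def cN using F cc c[OF i] by simp
  have y: "y \<in> carrier_vec ?p" unfolding y_def using c[OF i] by (intro carrier_vecI) auto
  \<comment> \<open>The residual at the centres is \<open>h\<close> and the displacement contributes
    through \<open>?F * D\<close>, so \<open>y\<close> is exactly the vector paired with
    \<open>w\<close> in \<open>block_quadratic_form\<close>.\<close>
  have yG: "?F * D *\<^sub>v stack s ?S + h = y"
  proof -
    have Ds: "D *\<^sub>v stack s ?S \<in> carrier_vec ?d" using D(1) st by simp
    have "y = (?F *\<^sub>v stack c ?S + ?F *\<^sub>v (D *\<^sub>v stack s ?S)) - c i"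
      unfolding y_def xN using mult_add_distrib_mat_vec[OF F cc Ds] by simp
    then show ?thesis
      unfolding h_def cN using assoc_mult_mat_vec[OF F D(1) st] F c[OF i]
      by (intro eq_vecI) auto
  qed
  have lP: "l j \<cdot>\<^sub>m P_nbr M n P ?S j \<in> carrier_mat ?d ?d" if "j \<in> ?S" for j
    using P_nbr_carrier[of ?S M j P n] S that P by auto
  have Q: "Q \<in> carrier_mat ?d ?d"
    and Qs: "stack s ?S \<bullet> (Q *\<^sub>v stack s ?S)
      = (\<Sum>j\<in>?S. stack s ?S \<bullet> (l j \<cdot>\<^sub>m P_nbr M n P ?S j *\<^sub>v stack s ?S))"
    unfolding Q_def using finsum_mat_mult_vec[OF fin lP st] by auto
  \<comment> \<open>Here the multipliers act: as each \<open>l j\<close> is nonnegative, the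
    constraints \<open>s j \<bullet> (P j *\<^sub>v s j) \<le> 1\<close> may be weighted by
    \<open>l j\<close> and summed.\<close>
  have "stack s ?S \<bullet> (Q *\<^sub>v stack s ?S) \<le> (\<Sum>j\<in>?S. l j)"
    unfolding Qs
  proof (rule sum_mono)
    fix j assume j: "j \<in> ?S"
    then have Pj: "P j \<in> carrier_mat (n j) (n j)" using S P by blast
    have Pn: "P_nbr M n P ?S j \<in> carrier_mat ?d ?d" by (rule P_nbr_carrier[of _ _ _ P n, OF S j Pj])
    have "stack s ?S \<bullet> (l j \<cdot>\<^sub>m P_nbr M n P ?S j *\<^sub>v stack s ?S) = l j * (s j \<bullet> (P j *\<^sub>v s j))"
      using P_nbr_quadratic_form[where s = s and P = P and n = n, OF S j Pj s] Pn st
      by (simp add: smult_mat_mult_vec)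
    also have "\<dots> \<le> l j * 1" using l s1 j by (intro mult_left_mono) auto
    finally show "stack s ?S \<bullet> (l j \<cdot>\<^sub>m P_nbr M n P ?S j *\<^sub>v stack s ?S) \<le> l j" by simp
  qed
  \<comment> \<open>The parameters \<open>s\<close> are fixed by the given state while
    \<open>w\<close> stays free; semidefiniteness is used at the vector composed of
    \<open>w\<close>, the stacked \<open>s\<close> and 1.\<close>
  moreover have "0 \<le> sqrt (\<alpha> i) * (w \<bullet> (the (mat_inverse (P i)) *\<^sub>v w)) + 2 * (w \<bullet> y)
      + stack s ?S \<bullet> (Q *\<^sub>v stack s ?S) + (sqrt (\<alpha> i) - (\<Sum>j\<in>?S. l j))"
    if w: "w \<in> carrier_vec ?p" for w
  proof -
    note R = pos_def_mat_inverse(1)[OF Pi]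
    have X: "sqrt (\<alpha> i) \<cdot>\<^sub>m the (mat_inverse (P i)) \<in> carrier_mat ?p ?p" using R by simp
    let ?\<rho> = "sqrt (\<alpha> i) - (\<Sum>j\<in>?S. l j)"
    note dims = block_quadratic_form(1)[OF X G Q h w st, where \<rho> = ?\<rho>]
      block_quadratic_form(2)[OF X G Q h w st]
    note val = block_quadratic_form(3)[OF X G Q h w st, where \<rho> = ?\<rho>, unfolded yG]
    have "sqrt (\<alpha> i) \<cdot>\<^sub>m the (mat_inverse (P i)) *\<^sub>v w = sqrt (\<alpha> i) \<cdot>\<^sub>v (the (mat_inverse (P i)) *\<^sub>v w)"
      using R w by (simp add: smult_mat_mult_vec)
    then have "w \<bullet> (sqrt (\<alpha> i) \<cdot>\<^sub>m the (mat_inverse (P i)) *\<^sub>v w)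
        = sqrt (\<alpha> i) * (w \<bullet> (the (mat_inverse (P i)) *\<^sub>v w))"
      using R w by simp
    \<comment> \<open>Folding the abbreviations brings the block matrix to the shape treated in
      \<open>block_quadratic_form\<close>, so \<open>val\<close> evaluates its form.\<close>
    moreover note psd[unfolded invariance_lmi_def Let_def pos_semidef_mat_def,
        folded D_def h_def Q_def]
    ultimately show ?thesis using dims val by (metis carrier_matD(1))
  qed
  \<comment> \<open>The upper bound for the term in \<open>Q\<close> cancels the multiplier sum in
    the corner entry, leaving \<open>sqrt (\<alpha> i)\<close> as the constant.\<close>
  ultimately have "0 \<le> sqrt (\<alpha> i) * (w \<bullet> (the (mat_inverse (P i)) *\<^sub>v w)) + 2 * (w \<bullet> y) + sqrt (\<alpha> i)"
    if "w \<in> carrier_vec ?p" for w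
    using that by fastforce
  then have "y \<bullet> (P i *\<^sub>v y) \<le> (sqrt (\<alpha> i))\<^sup>2"
    using \<alpha>[OF i] by (intro quadratic_form_le_of_schur[OF Pi y]) auto
  then show "(?F *\<^sub>v xN - c i) \<bullet> (P i *\<^sub>v (?F *\<^sub>v xN - c i)) \<le> \<alpha> i"
    using \<alpha>[OF i] unfolding y_def by simp
qed

end
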